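(* Let $F(x)=\frac{2x}{1+x}$ for $x\in[0,1]$. If a disagreement bound $f$ satisfies $f(x)\le F(x)$ for all $x\in[0,1]$, then $f=F$ on $[0,1]$. Moreover, if a disagreement bound $f$ satisfies $f(x)\le F(x)$ for all $x$ in some open interval $(a,b)\subset[0,1]$, then $f(x)=F(x)$ for all $x\in(a,b)$.
   Context: A coupling of a collection of random variables $(X_i)_{i\in I}$ is a family $(X_i')_{i\in I}$ of random variables on one common probability space such that each $X_i'$ has the same law as $X_i$; primes are omitted. The total variation distance is $d_{\mathrm{TV}}(X,Y)=\sup_A|\mathbb P(X\in A)-\mathbb P(Y\in A)|$, over all measurable sets $A$. A function $f:[0,1]\to[0,1]$ is called a disagreement bound if for any finite collection of random variables there is a coupling of the variables such that any two of them, say $X$ and $Y$, satisfy $\mathbb P(X\neq Y)\le f(d_{\mathrm{TV}}(X,Y))$. *)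

theory Defs
  imports "HOL-Probability.Probability"
begin

definition tv_dist ::
    "'s measure \<Rightarrow> 'w measure \<Rightarrow> ('w \<Rightarrow> 's) \<Rightarrow> 'v measure \<Rightarrow> ('v \<Rightarrow> 's) \<Rightarrow> real" where
  "tv_dist S M X N Y =
     (SUP A\<in>sets S. \<bar>measure M {\<omega>\<in>space M. X \<omega> \<in> A} - measure N {\<omega>\<in>space N. Y \<omega> \<in> A}\<bar>)"

definition is_coupling ::
    "'s measure \<Rightarrow> 'i set \<Rightarrow> ('i \<Rightarrow> 'w measure) \<Rightarrow> ('i \<Rightarrow> 'w \<Rightarrow> 's) \<Rightarrow>
     'p measure \<Rightarrow> ('i \<Rightarrow> 'p \<Rightarrow> 's) \<Rightarrow> bool" where
  "is_coupling S I M X P X' \<longleftrightarrow>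
     prob_space P \<and>
     (\<forall>i\<in>I. X' i \<in> measurable P S \<and> distr P S (X' i) = distr (M i) S (X i))"

text \<open>
  The type parameter \<open>'a\<close> is the universe of values: \<open>S\<close> ranges over all measurable spaces on
  subsets of \<open>'a\<close>.  A bound for arbitrary value spaces is one for every \<open>'a\<close>; so a result
  assuming it for a single infinite \<open>'a\<close> assumes less.  The types of the sample spaces lose no generality.  Each law on \<open>S\<close> is the law
  of the identity on a probability space over \<open>'a\<close>.  A coupling \<open>(X' i)\<close> on a probability space
  over any type can be transported along \<open>\<omega> \<mapsto> (\<lambda>i. X' i \<omega>)\<close> to one over \<open>nat \<Rightarrow> 'a\<close>
  carrying the largest \<open>\<sigma>\<close>-algebra that makes this map measurable, so that the disagreement events
  remain events.

  The diagonal of \<open>S\<close> need not be measurable, and \<open>measure\<close> is 0 on non-measurable sets; hence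
  the coupling is required to make the disagreement sets events.  This is automatic whenever the
  diagonal is measurable, e.g. for standard Borel \<open>S\<close>.
\<close>

definition disagreement_bound :: "'a itself \<Rightarrow> (real \<Rightarrow> real) \<Rightarrow> bool" where
  "disagreement_bound (_ :: 'a itself) f \<longleftrightarrow>
     f \<in> {0..1} \<rightarrow> {0..1} \<and>
     (\<forall>(S :: 'a measure) (I :: nat set) (M :: nat \<Rightarrow> 'a measure) (X :: nat \<Rightarrow> 'a \<Rightarrow> 'a).
        finite I \<and> (\<forall>i\<in>I. prob_space (M i) \<and> X i \<in> measurable (M i) S) \<longrightarrow>
        (\<exists>(P :: (nat \<Rightarrow> 'a) measure) X'.
           is_coupling S I M X P X' \<and>
           (\<forall>i\<in>I. \<forall>j\<in>I.
              {\<omega>\<in>space P. X' i \<omega> \<noteq> X' j \<omega>} \<in> sets P \<and>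
              measure P {\<omega>\<in>space P. X' i \<omega> \<noteq> X' j \<omega>}
                \<le> f (tv_dist S (M i) (X i) (M j) (X j)))))"

definition F :: "real \<Rightarrow> real" where
  "F x = 2 * x / (1 + x)"

end

theory Submission
  imports Defs
begin

text \<open>
  Every disagreement bound satisfies \<open>f x \<ge> F x\<close> at each \<open>x\<close>, with no assumption at other points:
  there are large families of laws in which almost all pairs are at distance exactly \<open>x\<close> and
  agree, in any coupling, with average probability at most about \<open>(1 - x) / (1 + x) = 1 - F x\<close>.

  The laws are indexed by pairs \<open>(i, B)\<close> with \<open>i < r\<close> and \<open>B\<close> a \<open>k\<close>-subset of \<open>{..<s}\<close>; such a law is
  uniform on the functions \<open>g : {..<r} \<rightarrow> {..<s}\<close> with \<open>g i \<in> B\<close>.  Two laws with different \<open>i\<close> are at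
  distance exactly \<open>1 - k / s\<close>, and a small mass \<open>\<eta>\<close> moved to a common atom tunes this to \<open>x\<close>.
  Any \<open>m\<close> functions \<open>g\<close> take at most \<open>m\<close> values in each coordinate \<open>i\<close>, hence lie outside
  at least a fraction \<open>(s - m choose k) / (s choose k) \<approx> x ^ m\<close> of the supports.  So if \<open>\<phi> g\<close> is the fraction
  of variables taking the value \<open>g\<close>, any \<open>m\<close> of the numbers \<open>\<phi> g\<close> sum to at most about \<open>1 - x ^ m\<close>, and by
  majorization \<open>\<Sum> (\<phi> g)\<^sup>2\<close>, the fraction of agreeing pairs, is at most about
  \<open>\<Sum>m. ((1 - x) * x ^ m)\<^sup>2 = (1 - x) / (1 + x)\<close>.
\<close>

section \<open>Abel summation and majorization of sums of squares\<close>

text \<open>Abel summation: an antitone nonnegative \<open>a\<close> is a nonnegative combination of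
  indicators of initial segments with total weight \<open>a 0\<close>, and each segment contributes
  a partial sum of \<open>c\<close>, hence at most \<open>e\<close>.\<close>

lemma sum_antimono_mult_le:
  fixes a c :: "nat \<Rightarrow> real"
  assumes anti: "\<And>i. Suc i < n \<Longrightarrow> a (Suc i) \<le> a i"
    and nonneg: "\<And>i. i < n \<Longrightarrow> 0 \<le> a i"
    and partial: "\<And>m. m \<le> n \<Longrightarrow> (\<Sum>i<m. c i) \<le> e"
    and "0 < n"
  shows "(\<Sum>i<n. a i * c i) \<le> a 0 * e"
proof -
  \<comment> \<open>The drops \<open>a i - a (Suc i)\<close> up to \<open>m\<close> have been
    charged \<open>e\<close> each and telescope to \<open>a 0 - a m\<close>; the remaining weight
    \<open>a m\<close> still carries the exact partial sum.\<close>
  have main: "(\<Sum>i<Suc m. a i * c i) \<le> a m * (\<Sum>i<Suc m. c i) + (a 0 - a m) * e"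
    if "m < n" for m
    using that
  proof (induction m)
    case (Suc m)
    have "(a m - a (Suc m)) * (\<Sum>i<Suc m. c i) \<le> (a m - a (Suc m)) * e"
      using anti[of m] partial[of "Suc m"] Suc.prems by (intro mult_left_mono) auto
    with Suc show ?case by (simp add: algebra_simps)
  qed simp
  obtain m where m: "n = Suc m" using \<open>0 < n\<close> by (cases n) auto
  have "a m * (\<Sum>i<n. c i) \<le> a m * e"
    using nonneg[of m] partial[of n] m by (intro mult_left_mono) auto
  with main[of m] m show ?thesis by (simp add: algebra_simps)
qed

lemma ex_bij_betw_nat_finite_antimono:
  fixes \<phi> :: "'b \<Rightarrow> real"
  assumes "finite G"
  obtains h where "bij_betw h {..<card G} G" "\<And>i. Suc i < card G \<Longrightarrow> \<phi> (h (Suc i)) \<le> \<phi> (h i)"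
proof -
  obtain xs where xs: "set xs = G" "distinct xs" using finite_distinct_list[OF assms] by blast
  define ys where "ys = sort_key (\<lambda>g. - \<phi> g) xs"
  have ys: "set ys = G" "distinct ys" "length ys = card G"
    using xs distinct_card[of xs] by (auto simp: ys_def)
  have "sorted (map (\<lambda>g. - \<phi> g) ys)" by (simp add: ys_def)
  then have "\<phi> (ys ! Suc i) \<le> \<phi> (ys ! i)" if "Suc i < card G" for i
    using sorted_nth_mono[of "map (\<lambda>g. - \<phi> g) ys" i "Suc i"] that ys by simp
  moreover have "bij_betw ((!) ys) {..<card G} G"
    using bij_betw_nth[OF ys(2)] ys by simp
  ultimately show thesis using that by blast
qed

text \<open>
  Majorization: the greedy sequence \<open>(1 - t) * t ^ i\<close>, whose partial sums are \<open>1 - t ^ m\<close>,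
  maximizes the sum of squares.
\<close>
lemma sum_squares_le_of_subset_sums:
  fixes \<phi> :: "'b \<Rightarrow> real"
  assumes fin: "finite G" and nonneg: "\<And>g. g \<in> G \<Longrightarrow> 0 \<le> \<phi> g"
    and le_one: "\<And>g. g \<in> G \<Longrightarrow> \<phi> g \<le> 1"
    and t: "0 \<le> t" "t < 1" and e: "0 \<le> e"
    and part: "\<And>H. H \<subseteq> G \<Longrightarrow> (\<Sum>g\<in>H. \<phi> g) \<le> 1 - t ^ card H + e"
  shows "(\<Sum>g\<in>G. (\<phi> g)\<^sup>2) \<le> (1 - t) / (1 + t) + 2 * e"
proof (cases "G = {}")
  case True
  then show ?thesis using t e by simp
next
  case False
  define n where "n = card G"
  have "0 < n" using False fin by (simp add: n_def card_gt_0_iff)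
  obtain h where h: "bij_betw h {..<n} G"
    and anti: "\<And>i. Suc i < n \<Longrightarrow> \<phi> (h (Suc i)) \<le> \<phi> (h i)"
    using ex_bij_betw_nat_finite_antimono[OF fin, of \<phi>] unfolding n_def by blast
  define a where "a = (\<lambda>i. \<phi> (h i))"
  define b where "b = (\<lambda>i. (1 - t) * t ^ i)"
  have hG: "h i \<in> G" if "i < n" for i using bij_betwE[OF h] that by auto
  have b_sum: "(\<Sum>i<m. b i) = 1 - t ^ m" for m
    by (induction m) (auto simp: b_def algebra_simps)
  \<comment> \<open>This is \<open>part\<close> for the \<open>m\<close> points where
    \<open>\<phi>\<close> is largest.\<close>
  have "(\<Sum>i<m. a i - b i) \<le> e" if "m \<le> n" for m
  proof -
    have inj: "inj_on h {..<m}"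
      using h that by (auto simp: bij_betw_def intro: inj_on_subset)
    have "h ` {..<m} \<subseteq> G" using hG that by auto
    from part[OF this] have "(\<Sum>i<m. a i) \<le> 1 - t ^ m + e"
      using inj by (simp add: sum.reindex card_image a_def o_def)
    then show ?thesis by (simp add: sum_subtractf b_sum)
  qed
  then have "(\<Sum>i<n. a i * (a i - b i)) \<le> a 0 * e"
    using anti nonneg hG \<open>0 < n\<close> by (intro sum_antimono_mult_le) (auto simp: a_def)
  also have "\<dots> \<le> 1 * e"
    using le_one[OF hG[OF \<open>0 < n\<close>]] e by (intro mult_right_mono) (auto simp: a_def)
  finally have ab: "(\<Sum>i<n. a i * (a i - b i)) \<le> e" by simp
  \<comment> \<open>Expanding \<open>(a i - b i)\<^sup>2\<close> around \<open>a i\<close> leaves a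
    linear term whose weight is the antitone \<open>a\<close> itself, so Abel summation applies; its
    factor 2 becomes the one in \<open>2 * e\<close>.\<close>
  have "(\<Sum>i<n. (a i)\<^sup>2) \<le> (\<Sum>i<n. 2 * (a i * (a i - b i)) + (b i)\<^sup>2)"
  proof (intro sum_mono)
    fix i
    show "(a i)\<^sup>2 \<le> 2 * (a i * (a i - b i)) + (b i)\<^sup>2"
      using zero_le_power2[of "a i - b i"] by (simp add: power2_eq_square algebra_simps)
  qed
  also have "\<dots> = 2 * (\<Sum>i<n. a i * (a i - b i)) + (\<Sum>i<n. (b i)\<^sup>2)"
    by (simp add: sum.distrib sum_distrib_left)
  also have "(\<Sum>i<n. (b i)\<^sup>2) \<le> (1 - t) / (1 + t)"
  proof -
    have "(1 + t) * (\<Sum>i<n. (b i)\<^sup>2) = (1 - t) * (1 - (t ^ n)\<^sup>2)"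
      by (induction n) (auto simp: b_def algebra_simps power2_eq_square)
    also have "\<dots> \<le> (1 - t) * 1" using t by (intro mult_left_mono) auto
    finally show ?thesis using t by (simp add: field_simps)
  qed
  finally have "(\<Sum>i<n. (a i)\<^sup>2) \<le> (1 - t) / (1 + t) + 2 * e" using ab by linarith
  moreover have "(\<Sum>i<n. (a i)\<^sup>2) = (\<Sum>g\<in>G. (\<phi> g)\<^sup>2)"
    unfolding a_def by (rule sum.reindex_bij_betw[OF h])
  ultimately show ?thesis by simp
qed

section \<open>Agreeing pairs and ratios of binomial coefficients\<close>

text \<open>Here \<open>c\<close> stands for the values of all variables at one outcome. The classes
  of indices taking a common value \<open>g\<close> inside their sets are disjoint, and those with
  \<open>g\<close> in \<open>H\<close> consist of indices whose sets meet \<open>H\<close>. So the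
  class proportions satisfy the majorization hypothesis, and the agreeing pairs are the union of the
  squares of the classes.\<close>

lemma card_agreeing_pairs_le:
  fixes A :: "'i \<Rightarrow> 'b set" and c :: "'i \<Rightarrow> 'b"
  assumes fin: "finite I" and ne: "I \<noteq> {}"
    and t: "0 \<le> t" "t < 1" and e: "0 \<le> e"
    and cover: "\<And>H. finite H \<Longrightarrow>
      real (card {i \<in> I. A i \<inter> H \<noteq> {}}) \<le> real (card I) * (1 - t ^ card H + e)"
  shows "real (card {(i, j) \<in> I \<times> I. c i = c j \<and> c i \<in> A i \<and> c j \<in> A j})
    \<le> (real (card I))\<^sup>2 * ((1 - t) / (1 + t) + 2 * e)"
proof -
  define N where "N = real (card I)"
  have N: "N > 0" using fin ne by (simp add: N_def card_gt_0_iff)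
  define B where "B = (\<lambda>g. {i \<in> I. c i = g \<and> g \<in> A i})"
  have finB: "finite (B g)" for g using fin by (simp add: B_def)
  have part: "(\<Sum>g\<in>H. real (card (B g)) / N) \<le> 1 - t ^ card H + e" if H: "H \<subseteq> c ` I" for H
  proof -
    have finH: "finite H" using H fin finite_surj by blast
    have "(\<Sum>g\<in>H. card (B g)) = card (\<Union>g\<in>H. B g)"
      using finH finB by (subst card_UN_disjoint) (auto simp: B_def)
    also have "\<dots> \<le> card {i \<in> I. A i \<inter> H \<noteq> {}}"
      using fin by (intro card_mono) (auto simp: B_def)
    finally have "(\<Sum>g\<in>H. real (card (B g))) \<le> N * (1 - t ^ card H + e)"
      using cover[OF finH] unfolding N_def by (simp flip: of_nat_sum)
    then show ?thesis using N by (simp add: sum_divide_distrib[symmetric] field_simps)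
  qed
  have "real (card (B g)) / N \<le> 1" for g
    using card_mono[OF fin, of "B g"] N by (auto simp: N_def B_def divide_le_eq)
  then have sq: "(\<Sum>g\<in>c ` I. (real (card (B g)) / N)\<^sup>2) \<le> (1 - t) / (1 + t) + 2 * e"
    using fin N t e part by (intro sum_squares_le_of_subset_sums) auto
  have "{(i, j) \<in> I \<times> I. c i = c j \<and> c i \<in> A i \<and> c j \<in> A j} = (\<Union>g\<in>c ` I. B g \<times> B g)"
    by (auto simp: B_def)
  moreover have "card (\<Union>g\<in>c ` I. B g \<times> B g) = (\<Sum>g\<in>c ` I. card (B g) * card (B g))"
    using fin finB by (subst card_UN_disjoint) (auto simp: B_def card_cartesian_product)
  ultimately have "real (card {(i, j) \<in> I \<times> I. c i = c j \<and> c i \<in> A i \<and> c j \<in> A j})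
      = N\<^sup>2 * (\<Sum>g\<in>c ` I. (real (card (B g)) / N)\<^sup>2)"
    using N by (simp add: sum_distrib_left power_divide power2_eq_square)
  also have "\<dots> \<le> N\<^sup>2 * ((1 - t) / (1 + t) + 2 * e)"
    using sq by (intro mult_left_mono) auto
  finally show ?thesis by (simp add: N_def)
qed

text \<open>Lowering the upper index from \<open>n\<close> to \<open>n - 1\<close> multiplies
  \<open>n choose k\<close> by \<open>(n - k) / n\<close>. The slack \<open>M\<close> keeps this
  factor at least \<open>t\<close> during the first \<open>M\<close> steps.\<close>

lemma choose_diff_ge_power:
  fixes t :: real
  assumes "0 \<le> t" "k \<le> s" "t * real s + real M \<le> real s - real k" "m \<le> M"
  shows "t ^ m * real (s choose k) \<le> real ((s - m) choose k)"
  using \<open>m \<le> M\<close>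
proof (induction m)
  case (Suc m)
  define n where "n = s - m"
  have "real (Suc m) \<le> real s - real k"
    using assms(1,3) Suc.prems mult_nonneg_nonneg[of t "real s"] by linarith
  then have km: "k + m < s" by linarith
  have n: "0 < n" "k < n" "real n = real s - real m" using km by (auto simp: n_def)
  have "t * real n \<le> t * real s" using n assms(1) by (intro mult_left_mono) auto
  then have tn: "t * real n \<le> real n - real k" using assms(3) Suc.prems n by linarith
  have "real (n - k) * real (n choose k) = real n * real ((n - 1) choose k)"
    using binomial_absorb_comp[of n k] by (metis of_nat_mult)
  then have "real n * real ((n - 1) choose k) = (real n - real k) * real (n choose k)"
    using n by (simp add: of_nat_diff)
  also have "\<dots> \<ge> (t * real n) * real (n choose k)" using tn by (intro mult_right_mono) auto
  finally have "t * real (n choose k) \<le> real ((n - 1) choose k)"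
    using n(1) by (simp add: mult.assoc mult.left_commute[of t])
  moreover have "t * (t ^ m * real (s choose k)) \<le> t * real (n choose k)"
    using Suc assms(1) by (intro mult_left_mono) (auto simp: n_def)
  ultimately show ?case by (simp add: n_def algebra_simps)
qed simp

section \<open>Uniform laws with a common atom and their distances\<close>

text \<open>With the same \<open>z\<close> in every law, all pairwise distances shrink by the same
  factor \<open>1 - \<eta>\<close>. This turns a rational distance \<open>1 - k / s\<close> into an
  arbitrary prescribed one slightly below it.\<close>

definition atom_uniform_pmf :: "real \<Rightarrow> 'b \<Rightarrow> 'b set \<Rightarrow> 'b pmf" where
  "atom_uniform_pmf \<eta> z A =
     bind_pmf (bernoulli_pmf \<eta>) (\<lambda>b. if b then return_pmf z else pmf_of_set A)"

lemma measure_atom_uniform_pmf: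
  assumes "0 \<le> \<eta>" "\<eta> \<le> 1" "finite A" "A \<noteq> {}"
  shows "measure (atom_uniform_pmf \<eta> z A) E
    = \<eta> * indicator E z + (1 - \<eta>) * (real (card (A \<inter> E)) / real (card A))"
proof -
  have "measure (atom_uniform_pmf \<eta> z A) E
      = measure_pmf.expectation (atom_uniform_pmf \<eta> z A) (indicator E)"
    by simp
  also have "\<dots> = \<eta> * indicator E z + (1 - \<eta>) * (real (card (A \<inter> E)) / real (card A))"
    unfolding atom_uniform_pmf_def using assms
    by (subst pmf_expectation_bind[where A = UNIV]) (auto simp: UNIV_bool measure_pmf_of_set)
  finally show ?thesis .
qed

text \<open>The atom cancels in every difference of probabilities, and for two uniform laws on sets
  of equal size the supremum is attained at \<open>A - B\<close>.\<close>

lemma tv_dist_atom_uniform_pmf: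
  assumes "0 \<le> \<eta>" "\<eta> \<le> 1" "finite A" "finite B" "card A = K" "card B = K" "0 < K"
  shows "tv_dist (count_space UNIV) (measure_pmf (atom_uniform_pmf \<eta> z A)) (\<lambda>w. w)
      (measure_pmf (atom_uniform_pmf \<eta> z B)) (\<lambda>w. w)
    = (1 - \<eta>) * (1 - real (card (A \<inter> B)) / real K)"
proof -
  have ne: "A \<noteq> {}" "B \<noteq> {}" using assms by auto
  define d where "d = (\<lambda>E. \<bar>measure (atom_uniform_pmf \<eta> z A) E - measure (atom_uniform_pmf \<eta> z B) E\<bar>)"
  have d: "d E = (1 - \<eta>) * (\<bar>real (card (A \<inter> E)) - real (card (B \<inter> E))\<bar> / real K)" for E
    unfolding d_def using assms ne
    by (simp add: measure_atom_uniform_pmf flip: right_diff_distrib diff_divide_distrib)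
       (simp add: abs_mult)
  have split: "card (C \<inter> E) + card (D - C) \<ge> card (D \<inter> E)"
    if "finite C" "finite D" for C D E :: "'a set"
  proof -
    have "card (D \<inter> E) \<le> card ((C \<inter> E) \<union> (D - C))"
      using that by (intro card_mono) auto
    also have "\<dots> \<le> card (C \<inter> E) + card (D - C)" by (rule card_Un_le)
    finally show ?thesis .
  qed
  have diff: "real (card (A - B)) = real K - real (card (A \<inter> B))"
    "real (card (B - A)) = real K - real (card (A \<inter> B))"
    using assms card_Diff_subset_Int[of A B] card_Diff_subset_Int[of B A]
      card_mono[of A "A \<inter> B"] by (auto simp: of_nat_diff Int_commute)
  have val: "d (A - B) = (1 - \<eta>) * (1 - real (card (A \<inter> B)) / real K)"
  proof -
    have "A \<inter> (A - B) = A - B" "B \<inter> (A - B) = {}" by auto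
    then show ?thesis using diff(1) assms by (simp add: d diff_divide_distrib)
  qed
  have "d E \<le> d (A - B)" for E
  proof -
    have "\<bar>real (card (A \<inter> E)) - real (card (B \<inter> E))\<bar> \<le> real K - real (card (A \<inter> B))"
      using split[of A B E] split[of B A E] assms diff by linarith
    then have "d E \<le> (1 - \<eta>) * ((real K - real (card (A \<inter> B))) / real K)"
      unfolding d using assms by (intro mult_left_mono divide_right_mono) auto
    then show ?thesis using assms by (simp add: val diff_divide_distrib)
  qed
  then have "(SUP E. d E) = d (A - B)"
    by (intro cSup_eq_maximum) auto
  moreover have "tv_dist (count_space UNIV) (measure_pmf (atom_uniform_pmf \<eta> z A)) (\<lambda>w. w)
      (measure_pmf (atom_uniform_pmf \<eta> z B)) (\<lambda>w. w) = (SUP E. d E)"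
    by (simp add: tv_dist_def d_def)
  ultimately show ?thesis using val by simp
qed

section \<open>From couplings to counts of agreeing pairs\<close>

text \<open>Double counting: the number of pairs in \<open>R\<close> that agree inside their
  supports is at most \<open>L\<close> at every outcome, hence on average. Each pair contributes at
  least \<open>1 - f x - 2 * \<eta>\<close> to the average, since each of its two variables leaves
  its support with probability \<open>\<eta>\<close>.\<close>

lemma disagreement_bound_agreement_le:
  fixes A :: "nat \<Rightarrow> 'a set"
  assumes inf: "infinite (UNIV :: 'a set)" and f: "disagreement_bound TYPE('a) f"
    and fin: "finite I" and A: "\<And>i. i \<in> I \<Longrightarrow> finite (A i)" "\<And>i. i \<in> I \<Longrightarrow> card (A i) = K"
    and K: "0 < K" and \<eta>: "0 \<le> \<eta>" "\<eta> \<le> 1" and R: "R \<subseteq> I \<times> I"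
    and dist: "\<And>i j. (i, j) \<in> R \<Longrightarrow> (1 - \<eta>) * (1 - real (card (A i \<inter> A j)) / real K) = x"
    and agree: "\<And>c. real (card {(i, j) \<in> R. c i = c j \<and> c i \<in> A i \<and> c j \<in> A j}) \<le> L"
  shows "real (card R) * (1 - f x) \<le> L + real (card R) * (2 * \<eta>)"
proof -
  have "finite (\<Union>i\<in>I. A i)" using fin A by auto
  then obtain z where z: "z \<notin> (\<Union>i\<in>I. A i)" using inf ex_new_if_finite by blast
  define q where "q = (\<lambda>i. atom_uniform_pmf \<eta> z (A i))"
  define S where "S = (count_space UNIV :: 'a measure)"
  \<comment> \<open>The laws themselves serve as sample spaces, with identity maps as variables and
    a discrete value space.\<close>
  have "\<exists>(P :: (nat \<Rightarrow> 'a) measure) X'.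
           is_coupling S I (\<lambda>i. measure_pmf (q i)) (\<lambda>i w. w) P X' \<and>
           (\<forall>i\<in>I. \<forall>j\<in>I.
              {\<omega>\<in>space P. X' i \<omega> \<noteq> X' j \<omega>} \<in> sets P \<and>
              measure P {\<omega>\<in>space P. X' i \<omega> \<noteq> X' j \<omega>}
                \<le> f (tv_dist S (measure_pmf (q i)) (\<lambda>w. w) (measure_pmf (q j)) (\<lambda>w. w)))"
    using f fin unfolding disagreement_bound_def
    by (elim conjE allE[where x = S] allE[where x = I]
        allE[where x = "\<lambda>i. measure_pmf (q i)"] allE[where x = "\<lambda>i w. w"])
       (auto simp: S_def measure_pmf.prob_space_axioms)
  then obtain P :: "(nat \<Rightarrow> 'a) measure" and X where
      coup: "is_coupling S I (\<lambda>i. measure_pmf (q i)) (\<lambda>i w. w) P X"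
    and ne_sets: "\<And>i j. i \<in> I \<Longrightarrow> j \<in> I \<Longrightarrow> {\<omega>\<in>space P. X i \<omega> \<noteq> X j \<omega>} \<in> sets P"
    and ne_le: "\<And>i j. i \<in> I \<Longrightarrow> j \<in> I \<Longrightarrow> measure P {\<omega>\<in>space P. X i \<omega> \<noteq> X j \<omega>}
                \<le> f (tv_dist S (measure_pmf (q i)) (\<lambda>w. w) (measure_pmf (q j)) (\<lambda>w. w))"
    by blast
  interpret P: prob_space P using coup by (simp add: is_coupling_def)
  have X[measurable]: "X i \<in> measurable P S" if "i \<in> I" for i
    using coup that by (simp add: is_coupling_def)
  have law: "measure P (X i -` E \<inter> space P) = measure (q i) E" if "i \<in> I" for i E
  proof -
    have "measure P (X i -` E \<inter> space P) = measure (distr P S (X i)) E"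
      using X[OF that] by (subst measure_distr) (auto simp: S_def)
    also have "\<dots> = measure (distr (measure_pmf (q i)) S (\<lambda>w. w)) E"
      using coup that by (simp add: is_coupling_def)
    also have "\<dots> = measure (q i) E"
      by (subst measure_distr) (auto simp: S_def)
    finally show ?thesis .
  qed
  define Off where "Off = (\<lambda>i. X i -` (- A i) \<inter> space P)"
  have Off_sets: "Off i \<in> sets P" if "i \<in> I" for i
    unfolding Off_def using X[OF that] by (rule measurable_sets) (simp add: S_def)
  have Off: "measure P (Off i) = \<eta>" if "i \<in> I" for i
  proof -
    have "A i \<noteq> {}" using A(2)[OF that] K by auto
    then show ?thesis
      using z A that \<eta> by (simp add: Off_def law q_def measure_atom_uniform_pmf)
  qed
  define Good where "Good = (\<lambda>(i, j). {\<omega>\<in>space P. X i \<omega> = X j \<omega> \<and> X i \<omega> \<in> A i \<and> X j \<omega> \<in> A j})"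
  \<comment> \<open>Agreement is measurable as the complement of the disagreement event, which the
    disagreement bound provides as an event; the diagonal itself might not be measurable.\<close>
  have Good_eq: "Good (i, j) = space P - {\<omega>\<in>space P. X i \<omega> \<noteq> X j \<omega>} - Off i - Off j" for i j
    by (auto simp: Good_def Off_def)
  have Good_sets: "Good ij \<in> sets P" if "ij \<in> R" for ij
    using that R Off_sets ne_sets by (cases ij) (auto simp: Good_eq)
  have pair: "1 - f x \<le> measure P (Good ij) + 2 * \<eta>" if "ij \<in> R" for ij
  proof -
    obtain i j where ij: "ij = (i, j)" by (cases ij)
    then have I: "i \<in> I" "j \<in> I" using R that by auto
    have "tv_dist S (measure_pmf (q i)) (\<lambda>w. w) (measure_pmf (q j)) (\<lambda>w. w) = x"
      using tv_dist_atom_uniform_pmf[OF \<eta> A(1)[OF I(1)] A(1)[OF I(2)] A(2)[OF I(1)] A(2)[OF I(2)] K]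
        dist that ij by (simp add: S_def q_def)
    with ne_le[OF I] have le: "measure P {\<omega>\<in>space P. X i \<omega> \<noteq> X j \<omega>} \<le> f x" by simp
    have "1 = measure P (space P)" by (simp add: P.prob_space)
    also have "\<dots> = measure P ({\<omega>\<in>space P. X i \<omega> \<noteq> X j \<omega>} \<union> (Good ij \<union> (Off i \<union> Off j)))"
      by (rule arg_cong[where f = "measure P"]) (auto simp: ij Good_def Off_def)
    also have "\<dots> \<le> measure P {\<omega>\<in>space P. X i \<omega> \<noteq> X j \<omega>} + measure P (Good ij \<union> (Off i \<union> Off j))"
      using ne_sets I Good_sets that Off_sets by (intro measure_Un_le) auto
    also have "measure P (Good ij \<union> (Off i \<union> Off j)) \<le> measure P (Good ij) + measure P (Off i \<union> Off j)"
      using I Good_sets that Off_sets by (intro measure_Un_le) auto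
    also have "measure P (Off i \<union> Off j) \<le> measure P (Off i) + measure P (Off j)"
      using I Off_sets by (intro measure_Un_le) auto
    finally show ?thesis using le Off I by simp
  qed
  have finR: "finite R" using R fin by (meson finite_SigmaI finite_subset)
  have int: "integrable P (indicator (Good ij) :: _ \<Rightarrow> real)" if "ij \<in> R" for ij
    using Good_sets[OF that] by (simp add: P.emeasure_eq_measure)
  have "(\<Sum>ij\<in>R. measure P (Good ij)) = (\<Sum>ij\<in>R. \<integral>\<omega>. indicator (Good ij) \<omega> \<partial>P)"
    using Good_sets by (intro sum.cong) (auto simp: Int_absorb1 sets.sets_into_space)
  also have "\<dots> = (\<integral>\<omega>. (\<Sum>ij\<in>R. indicator (Good ij) \<omega>) \<partial>P)"
    using int by (subst Bochner_Integration.integral_sum) auto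
  also have "\<dots> \<le> (\<integral>\<omega>. L \<partial>P)"
  proof (rule integral_mono)
    show "integrable P (\<lambda>\<omega>. \<Sum>ij\<in>R. indicator (Good ij) \<omega> :: real)"
      using int by (intro Bochner_Integration.integrable_sum) auto
    show "integrable P (\<lambda>\<omega>. L)" by simp
    fix \<omega> assume "\<omega> \<in> space P"
    then have "(\<Sum>ij\<in>R. indicator (Good ij) \<omega> :: real)
        = real (card {(i, j) \<in> R. X i \<omega> = X j \<omega> \<and> X i \<omega> \<in> A i \<and> X j \<omega> \<in> A j})"
      using finR
      by (subst card_eq_sum, subst of_nat_sum, intro sum.mono_neutral_cong_right)
         (auto simp: Good_def indicator_def)
    then show "(\<Sum>ij\<in>R. indicator (Good ij) \<omega>) \<le> L" using agree[of "\<lambda>i. X i \<omega>"] by simp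
  qed
  finally have "(\<Sum>ij\<in>R. measure P (Good ij)) \<le> L" by (simp add: P.prob_space)
  moreover have "(\<Sum>ij\<in>R. 1 - f x) \<le> (\<Sum>ij\<in>R. measure P (Good ij) + 2 * \<eta>)"
    using pair by (intro sum_mono) auto
  ultimately show ?thesis by (simp add: sum.distrib)
qed

text \<open>The definition of a disagreement bound fixes indices in \<open>nat\<close> and values in
  \<open>'a\<close>. Enumerating \<open>J\<close> and injecting the finite union of the supports
  into the infinite \<open>'a\<close> frees both types; injectivity preserves the sizes of supports
  and intersections.\<close>

lemma disagreement_bound_agreement_le_transport:
  fixes T :: "'i \<Rightarrow> 'b set"
  assumes inf: "infinite (UNIV :: 'a set)" and f: "disagreement_bound TYPE('a) f"
    and fin: "finite J" and T: "\<And>i. i \<in> J \<Longrightarrow> finite (T i)" "\<And>i. i \<in> J \<Longrightarrow> card (T i) = K"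
    and K: "0 < K" and \<eta>: "0 \<le> \<eta>" "\<eta> \<le> 1" and R: "R \<subseteq> J \<times> J"
    and dist: "\<And>i j. (i, j) \<in> R \<Longrightarrow> (1 - \<eta>) * (1 - real (card (T i \<inter> T j)) / real K) = x"
    and agree: "\<And>c. real (card {(i, j) \<in> R. c i = c j \<and> c i \<in> T i \<and> c j \<in> T j}) \<le> L"
  shows "real (card R) * (1 - f x) \<le> L + real (card R) * (2 * \<eta>)"
proof -
  define N where "N = card J"
  obtain h where h: "bij_betw h {..<N} J"
    using ex_bij_betw_nat_finite[OF fin] by (auto simp: N_def atLeast0LessThan)
  define G where "G = (\<Union>i\<in>J. T i)"
  have finG: "finite G" using fin T by (simp add: G_def)
  obtain V :: "'a set" where V: "finite V" "card V = card G"
    using infinite_arbitrarily_large[OF inf] by blast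
  obtain e where "bij_betw e G V" using finite_same_card_bij[OF finG V(1)] V(2) by auto
  then have e: "inj_on e G" by (simp add: bij_betw_def)
  have TG: "T i \<subseteq> G" if "i \<in> J" for i using that by (auto simp: G_def)
  have eT: "inj_on e (T i)" if "i \<in> J" for i using inj_on_subset[OF e TG[OF that]] .
  have hJ: "h i \<in> J" if "i < N" for i using bij_betwE[OF h] that by auto
  define R' where "R' = {(i, j). i < N \<and> j < N \<and> (h i, h j) \<in> R}"
  define hh where "hh = map_prod h h"
  have inj_hh: "inj_on hh ({..<N} \<times> {..<N})"
    unfolding hh_def using h by (intro map_prod_inj_on) (auto simp: bij_betw_def)
  have R'_sub: "R' \<subseteq> {..<N} \<times> {..<N}" by (auto simp: R'_def)
  have "hh ` R' = R"
  proof
    show "hh ` R' \<subseteq> R" by (auto simp: hh_def R'_def)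
    show "R \<subseteq> hh ` R'"
    proof
      fix ab assume ab: "ab \<in> R"
      then obtain a b where "ab = (a, b)" "a \<in> J" "b \<in> J" using R by auto
      moreover obtain i j where "i < N" "j < N" "a = h i" "b = h j"
        using \<open>a \<in> J\<close> \<open>b \<in> J\<close> bij_betw_imp_surj_on[OF h] by (metis imageE lessThan_iff)
      ultimately show "ab \<in> hh ` R'"
        using ab by (intro image_eqI[of _ _ "(i, j)"]) (auto simp: hh_def R'_def)
    qed
  qed
  then have card_R: "card R' = card R"
    using card_image[OF inj_on_subset[OF inj_hh R'_sub]] by simp
  have finR: "finite R" using R fin by (meson finite_SigmaI finite_subset)
  have "real (card R') * (1 - f x) \<le> L + real (card R') * (2 * \<eta>)"
  proof (rule disagreement_bound_agreement_le[where A = "\<lambda>i. e ` T (h i)", OF inf f])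
    show "(1 - \<eta>) * (1 - real (card (e ` T (h i) \<inter> e ` T (h j))) / real K) = x"
      if "(i, j) \<in> R'" for i j
    proof -
      have ij: "h i \<in> J" "h j \<in> J" "(h i, h j) \<in> R" using that hJ by (auto simp: R'_def)
      then have "e ` T (h i) \<inter> e ` T (h j) = e ` (T (h i) \<inter> T (h j))"
        using inj_on_image_Int[OF e TG TG] by simp
      moreover have "inj_on e (T (h i) \<inter> T (h j))"
        using eT[OF ij(1)] by (rule inj_on_subset) auto
      ultimately show ?thesis using dist[OF ij(3)] by (simp add: card_image)
    qed
    fix c :: "nat \<Rightarrow> 'a"
    define c' where "c' = (\<lambda>a. inv_into G e (c (inv_into {..<N} h a)))"
    have c': "c' (h i) \<in> T (h i)" "e (c' (h i)) = c i" if "i < N" "c i \<in> e ` T (h i)" for i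
    proof -
      obtain g where g: "g \<in> T (h i)" "c i = e g" using \<open>c i \<in> e ` T (h i)\<close> by auto
      then have "g \<in> G" using TG hJ that by blast
      then have "c' (h i) = g"
        using g e h that by (simp add: c'_def bij_betw_def)
      with g show "c' (h i) \<in> T (h i)" "e (c' (h i)) = c i" by simp_all
    qed
    define U where "U = {(i, j) \<in> R'. c i = c j \<and> c i \<in> e ` T (h i) \<and> c j \<in> e ` T (h j)}"
    have "card U = card (hh ` U)"
      by (rule card_image[symmetric], rule inj_on_subset[OF inj_hh]) (auto simp: U_def R'_def)
    also have "\<dots> \<le> card {(a, b) \<in> R. c' a = c' b \<and> c' a \<in> T a \<and> c' b \<in> T b}"
    proof (intro card_mono)
      show "finite {(a, b) \<in> R. c' a = c' b \<and> c' a \<in> T a \<and> c' b \<in> T b}"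
        by (rule finite_subset[OF _ finR]) auto
      show "hh ` U \<subseteq> {(a, b) \<in> R. c' a = c' b \<and> c' a \<in> T a \<and> c' b \<in> T b}"
      proof
        fix ab assume "ab \<in> hh ` U"
        then obtain i j where "ab = hh (i, j)" "(i, j) \<in> U" by auto
        then have ij: "ab = (h i, h j)" "(i, j) \<in> R'" "c i = c j"
            "c i \<in> e ` T (h i)" "c j \<in> e ` T (h j)"
          unfolding U_def hh_def mem_Collect_eq case_prod_conv map_prod_simp by blast+
        then have N: "i < N" "j < N" by (auto simp: R'_def)
        have "e (c' (h i)) = e (c' (h j))" using c' ij N by simp
        moreover have "c' (h i) \<in> G" "c' (h j) \<in> G" using c' ij N TG hJ by blast+
        ultimately have "c' (h i) = c' (h j)" using e by (simp add: inj_on_eq_iff)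
        moreover have "(h i, h j) \<in> R" using ij(2) by (simp add: R'_def)
        moreover have "c' (h i) \<in> T (h i)" "c' (h j) \<in> T (h j)" using c'(1) ij N by blast+
        ultimately show "ab \<in> {(a, b) \<in> R. c' a = c' b \<and> c' a \<in> T a \<and> c' b \<in> T b}"
          unfolding ij(1) mem_Collect_eq case_prod_conv by blast
      qed
    qed
    finally have "real (card U) \<le> L" using agree[of c'] by linarith
    then show "real (card {(i, j) \<in> R'. c i = c j \<and> c i \<in> e ` T (h i) \<and> c j \<in> e ` T (h j)}) \<le> L"
      by (simp add: U_def)
  qed (use T K \<eta> R'_sub hJ eT in \<open>auto simp: card_image\<close>)
  then show ?thesis by (simp add: card_R)
qed

section \<open>The family of slices of a finite function space\<close>

definition slices :: "nat \<Rightarrow> nat \<Rightarrow> nat \<Rightarrow> (nat \<times> nat set) set" where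
  "slices r s k = {..<r} \<times> {B. B \<subseteq> {..<s} \<and> card B = k}"

definition slice :: "nat \<Rightarrow> nat \<Rightarrow> nat \<times> nat set \<Rightarrow> (nat \<Rightarrow> nat) set" where
  "slice r s = (\<lambda>(x, B). {g \<in> {..<r} \<rightarrow>\<^sub>E {..<s}. g x \<in> B})"

lemma finite_slices: "finite (slices r s k)"
  unfolding slices_def by simp

lemma card_slices: "card (slices r s k) = r * (s choose k)"
  unfolding slices_def by (simp add: card_cartesian_product n_subsets)

text \<open>Constraining one coordinate leaves a product set, so slices and, by a second
  application, their intersections are counted by the product formula.\<close>

lemma PiE_restrict_coordinate:
  assumes "x \<in> I" "B \<subseteq> T x"
  shows "{g \<in> Pi\<^sub>E I T. g x \<in> B} = Pi\<^sub>E I (T(x := B))"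
proof
  show "{g \<in> Pi\<^sub>E I T. g x \<in> B} \<subseteq> Pi\<^sub>E I (T(x := B))"
    by (auto simp: PiE_iff extensional_def)
  show "Pi\<^sub>E I (T(x := B)) \<subseteq> {g \<in> Pi\<^sub>E I T. g x \<in> B}"
  proof
    fix g assume g: "g \<in> Pi\<^sub>E I (T(x := B))"
    then have "g x \<in> B" using assms(1) by (auto dest: PiE_mem[of _ _ _ x])
    moreover have "Pi\<^sub>E I (T(x := B)) \<subseteq> Pi\<^sub>E I T" using assms(2) by (intro PiE_mono) auto
    ultimately show "g \<in> {g \<in> Pi\<^sub>E I T. g x \<in> B}" using g by blast
  qed
qed

lemma card_slice:
  assumes "a \<in> slices r s k"
  shows "finite (slice r s a)" "card (slice r s a) = k * s ^ (r - 1)"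
proof -
  obtain x B where a: "a = (x, B)" "x \<in> {..<r}" "B \<subseteq> {..<s}" "card B = k"
    using assms by (auto simp: slices_def)
  show "finite (slice r s a)" by (simp add: a(1) slice_def finite_PiE)
  have "card (slice r s a) = (\<Prod>i<r. card (((\<lambda>_. {..<s})(x := B)) i))"
    using PiE_restrict_coordinate[of x "{..<r}" B "\<lambda>_. {..<s}"] a(2,3)
    by (simp only: a(1) slice_def case_prod_conv card_PiE finite_lessThan)
  also have "\<dots> = k * (\<Prod>i\<in>{..<r} - {x}. s)"
    using a(2,4) by (subst prod.remove[of _ x]) (auto intro: prod.cong)
  finally show "card (slice r s a) = k * s ^ (r - 1)" using a(2) by simp
qed

text \<open>Constraints on different coordinates are independent. Relative to one slice the
  intersection has proportion \<open>k / s\<close>, whatever the two \<open>k\<close>-sets are, so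
  all these pairs have the same distance.\<close>

lemma card_slice_Int:
  assumes "a \<in> slices r s k" "b \<in> slices r s k" "fst a \<noteq> fst b"
  shows "card (slice r s a \<inter> slice r s b) = k * k * s ^ (r - 2)"
proof -
  obtain x B where a: "a = (x, B)" "x \<in> {..<r}" "B \<subseteq> {..<s}" "card B = k"
    using assms by (auto simp: slices_def)
  obtain y C where b: "b = (y, C)" "y \<in> {..<r}" "C \<subseteq> {..<s}" "card C = k"
    using assms by (auto simp: slices_def)
  have xy: "x \<noteq> y" using assms(3) a(1) b(1) by simp
  define T where "T = (\<lambda>_ :: nat. {..<s})"
  have "slice r s a \<inter> slice r s b = {g \<in> {g \<in> Pi\<^sub>E {..<r} T. g x \<in> B}. g y \<in> C}"
    unfolding slice_def a(1) b(1) T_def by auto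
  also have "\<dots> = Pi\<^sub>E {..<r} (T(x := B, y := C))"
    using PiE_restrict_coordinate[of x "{..<r}" B T]
      PiE_restrict_coordinate[of y "{..<r}" C "T(x := B)"] a(2,3) b(2,3) xy
    by (simp add: T_def)
  finally have "card (slice r s a \<inter> slice r s b) = (\<Prod>i<r. card ((T(x := B, y := C)) i))"
    by (simp only: card_PiE finite_lessThan)
  also have "\<dots> = k * (\<Prod>i\<in>{..<r} - {x}. card ((T(x := B, y := C)) i))"
    using a(2,4) xy by (subst prod.remove[of _ x]) auto
  also have "(\<Prod>i\<in>{..<r} - {x}. card ((T(x := B, y := C)) i))
      = k * (\<Prod>i\<in>{..<r} - {x} - {y}. s)"
    using b(2,4) xy by (subst prod.remove[of _ y]) (auto simp: T_def intro: prod.cong)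
  also have "(\<Prod>i\<in>{..<r} - {x} - {y}. s) = s ^ (r - 2)"
    using a(2) b(2) xy by (simp add: card_Diff_singleton numeral_2_eq_2)
  finally show ?thesis by simp
qed

text \<open>The slice of \<open>(x, B)\<close> misses \<open>H\<close> whenever \<open>B\<close>
  avoids the values at \<open>x\<close> of the members of \<open>H\<close>. These are at most
  \<open>card H\<close> values, which leaves at least \<open>(s - card H) choose k\<close> sets
  \<open>B\<close> for each \<open>x\<close>.\<close>

lemma card_slices_meeting_le:
  assumes t: "0 \<le> t" "t < 1" and ks: "k \<le> s" "t * real s + real M \<le> real s - real k"
    and e: "t ^ M \<le> e" and H: "finite H"
  shows "real (card {a \<in> slices r s k. slice r s a \<inter> H \<noteq> {}})
    \<le> real (card (slices r s k)) * (1 - t ^ card H + e)"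
proof -
  define m where "m = card H"
  define c where "c = real (s choose k)"
  define W where "W = (\<lambda>x. {B. B \<subseteq> {..<s} - (\<lambda>g. g x) ` H \<and> card B = k})"
  have "(s - m) choose k \<le> card (W x)" for x
  proof -
    have "card ((\<lambda>g. g x) ` H) \<le> m" using H by (simp add: m_def card_image_le)
    moreover have "card {..<s} - card ((\<lambda>g. g x) ` H) \<le> card ({..<s} - (\<lambda>g. g x) ` H)"
      using H by (intro diff_card_le_card_Diff) auto
    ultimately have "s - m \<le> card ({..<s} - (\<lambda>g. g x) ` H)" by simp
    then show ?thesis by (simp add: W_def n_subsets binomial_right_mono)
  qed
  then have "r * ((s - m) choose k) \<le> (\<Sum>x<r. card (W x))"
    using sum_mono[of "{..<r}" "\<lambda>_. (s - m) choose k" "\<lambda>x. card (W x)"] by simp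
  also have "\<dots> = card (SIGMA x:{..<r}. W x)" by (simp add: W_def)
  also have "\<dots> \<le> card {a \<in> slices r s k. slice r s a \<inter> H = {}}"
    using finite_slices by (intro card_mono) (auto simp: slices_def slice_def W_def)
  finally have "real r * real ((s - m) choose k)
      \<le> real (card {a \<in> slices r s k. slice r s a \<inter> H = {}})"
    by (simp flip: of_nat_mult)
  \<comment> \<open>The power bound is available only for \<open>m \<le> M\<close>; for larger
    \<open>m\<close> the error \<open>e\<close> is at least \<open>t ^ m\<close> and the left side
    is not positive.\<close>
  moreover have "(t ^ m - e) * c \<le> real ((s - m) choose k)"
  proof (cases "m \<le> M")
    case True
    have "0 \<le> e" using e zero_le_power[OF t(1), of M] by linarith
    then have "(t ^ m - e) * c \<le> t ^ m * c" by (intro mult_right_mono) (auto simp: c_def)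
    also have "\<dots> \<le> real ((s - m) choose k)"
      unfolding c_def using choose_diff_ge_power[OF t(1) ks True] .
    finally show ?thesis .
  next
    case False
    then have "t ^ m \<le> t ^ M" using t by (intro power_decreasing) auto
    then have "(t ^ m - e) * c \<le> 0" using e by (intro mult_nonpos_nonneg) (auto simp: c_def)
    then show ?thesis by linarith
  qed
  then have "real r * ((t ^ m - e) * c) \<le> real r * real ((s - m) choose k)"
    by (intro mult_left_mono) auto
  moreover have "card (slices r s k) = card {a \<in> slices r s k. slice r s a \<inter> H \<noteq> {}}
      + card {a \<in> slices r s k. slice r s a \<inter> H = {}}"
    using finite_slices[of r s k]
    by (subst card_Un_disjoint[symmetric]) (auto intro: arg_cong[where f = card])
  then have "real (card (slices r s k)) = real (card {a \<in> slices r s k. slice r s a \<inter> H \<noteq> {}})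
      + real (card {a \<in> slices r s k. slice r s a \<inter> H = {}})" by simp
  ultimately have "real (card {a \<in> slices r s k. slice r s a \<inter> H \<noteq> {}})
      \<le> real (card (slices r s k)) - real r * ((t ^ m - e) * c)" by linarith
  also have "\<dots> = real (card (slices r s k)) * (1 - t ^ card H + e)"
    by (simp add: card_slices c_def m_def algebra_simps)
  finally show ?thesis .
qed

text \<open>For a given \<open>a\<close>, the indices with the same coordinate form a fraction
  \<open>1 / r\<close> of the family. Only pairs with different coordinates have a controlled
  distance, and this bounds the loss from dropping the others.\<close>

lemma card_slice_pairs_ge:
  "(real (card (slices r s k)))\<^sup>2 * (1 - 1 / real r)
    \<le> real (card {(a, b) \<in> slices r s k \<times> slices r s k. fst a \<noteq> fst b})"
proof (cases "r = 0")
  case True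
  then show ?thesis by (simp add: slices_def)
next
  case False
  define J where "J = slices r s k"
  define c where "c = s choose k"
  have J: "finite J" "card J = r * c" by (auto simp: J_def finite_slices card_slices c_def)
  define D where "D = {(a, b) \<in> J \<times> J. fst a = fst b}"
  have "D \<subseteq> (\<lambda>(a, B). (a, (fst a, B))) ` (J \<times> {B. B \<subseteq> {..<s} \<and> card B = k})"
    by (force simp: D_def J_def slices_def)
  then have "card D \<le> card (J \<times> {B. B \<subseteq> {..<s} \<and> card B = k})"
    using J by (intro surj_card_le) auto
  then have "card D \<le> card J * c" by (simp add: card_cartesian_product n_subsets c_def)
  moreover have "card (J \<times> J) = card {(a, b) \<in> J \<times> J. fst a \<noteq> fst b} + card D"
  proof -
    define E where "E = {(a, b) \<in> J \<times> J. fst a \<noteq> fst b}"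
    have "J \<times> J = E \<union> D" "E \<inter> D = {}" by (auto simp: D_def E_def)
    moreover have "finite (J \<times> J)" using J by simp
    ultimately have "card (J \<times> J) = card E + card D" by (metis card_Un_disjoint finite_Un)
    then show ?thesis by (simp add: E_def)
  qed
  ultimately have "card J * card J \<le> card {(a, b) \<in> J \<times> J. fst a \<noteq> fst b} + card J * c"
    by (simp add: card_cartesian_product)
  then have "real (card J * card J)
      \<le> real (card {(a, b) \<in> J \<times> J. fst a \<noteq> fst b} + card J * c)"
    by (rule of_nat_mono)
  then have "(real (card J))\<^sup>2 - real (card J) * real c
      \<le> real (card {(a, b) \<in> J \<times> J. fst a \<noteq> fst b})"
    unfolding of_nat_mult of_nat_add power2_eq_square by linarith
  moreover have "(real (card J))\<^sup>2 * (1 / real r) = real (card J) * real c"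
    using False by (simp add: J(2) power2_eq_square)
  ultimately have "(real (card J))\<^sup>2 * (1 - 1 / real r)
      \<le> real (card {(a, b) \<in> J \<times> J. fst a \<noteq> fst b})"
    unfolding right_diff_distrib mult_1_right by linarith
  then show ?thesis by (simp only: J_def)
qed

section \<open>Choice of parameters and passage to the limit\<close>

text \<open>The errors are \<open>2 * t ^ M\<close> from large sets \<open>H\<close>, doubled by
  majorization, \<open>2 * \<eta>\<close> from leaving the supports, and \<open>1 / r\<close> from
  the pairs with equal coordinates.\<close>

lemma disagreement_bound_slices:
  assumes inf: "infinite (UNIV :: 'a set)" and f: "disagreement_bound TYPE('a) f"
    and t: "0 \<le> t" "t < 1" and k: "0 < k" "k < s" and M: "t * real s + real M \<le> real s - real k"
    and r: "2 \<le> r" and \<eta>: "0 \<le> \<eta>" "\<eta> \<le> 1" and x: "(1 - \<eta>) * (1 - real k / real s) = x"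
  shows "1 - f x \<le> (1 - t) / (1 + t) + 2 * t ^ M + 2 * \<eta> + 1 / real r"
proof -
  define J where "J = slices r s k"
  define N where "N = real (card J)"
  define R where "R = {(a, b) \<in> J \<times> J. fst a \<noteq> fst b}"
  define l where "l = (1 - t) / (1 + t) + 2 * t ^ M"
  have "card J \<noteq> 0" using k r by (simp add: J_def card_slices)
  then have N: "N > 0" and ne: "J \<noteq> {}" by (auto simp: N_def)
  have finJ: "finite J" by (simp add: J_def finite_slices)
  have RJ: "R \<subseteq> J \<times> J" by (auto simp: R_def)
  have "1 - real k / real s \<in> {0..1}" using k by auto
  then have "x \<in> {0..1}" using x \<eta> by (auto simp: mult_le_one)
  then have fx: "0 \<le> f x" "f x \<le> 1" using f by (auto simp: disagreement_bound_def Pi_iff)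
  have "real (card R) * (1 - f x) \<le> N\<^sup>2 * l + real (card R) * (2 * \<eta>)"
  proof (rule disagreement_bound_agreement_le_transport[where J = J and T = "slice r s"
        and K = "k * s ^ (r - 1)", OF inf f finJ _ _ _ \<eta> RJ])
    show "(1 - \<eta>) * (1 - real (card (slice r s a \<inter> slice r s b)) / real (k * s ^ (r - 1))) = x"
      if "(a, b) \<in> R" for a b
    proof -
      have "card (slice r s a \<inter> slice r s b) = k * k * s ^ (r - 2)"
        using that by (intro card_slice_Int) (auto simp: R_def J_def)
      moreover have "s ^ (r - 1) = s * s ^ (r - 2)"
        using r by (metis Suc_1 Suc_diff_Suc Suc_le_lessD power_Suc diff_Suc_1')
      ultimately have "real (card (slice r s a \<inter> slice r s b)) / real (k * s ^ (r - 1))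
          = real k / real s" using k by simp
      then show ?thesis using x by simp
    qed
    fix c :: "nat \<times> nat set \<Rightarrow> nat \<Rightarrow> nat"
    have "real (card {(a, b) \<in> R. c a = c b \<and> c a \<in> slice r s a \<and> c b \<in> slice r s b})
        \<le> real (card {(a, b) \<in> J \<times> J. c a = c b \<and> c a \<in> slice r s a \<and> c b \<in> slice r s b})"
      using finJ RJ by (intro of_nat_mono card_mono) (auto intro: finite_subset[of _ "J \<times> J"])
    also have "\<dots> \<le> N\<^sup>2 * l"
      unfolding N_def l_def
    proof (rule card_agreeing_pairs_le[OF finJ ne t])
      show "real (card {a \<in> J. slice r s a \<inter> H \<noteq> {}}) \<le> real (card J) * (1 - t ^ card H + t ^ M)"
        if "finite H" for H
        unfolding J_def using t k M that by (intro card_slices_meeting_le) auto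
    qed (use t in auto)
    finally show "real (card {(a, b) \<in> R. c a = c b \<and> c a \<in> slice r s a \<and> c b \<in> slice r s b})
        \<le> N\<^sup>2 * l" .
  qed (use card_slice k in \<open>auto simp: J_def\<close>)
  moreover have "N\<^sup>2 * (1 - 1 / real r) \<le> real (card R)"
    unfolding N_def R_def J_def by (rule card_slice_pairs_ge)
  then have "N\<^sup>2 * (1 - 1 / real r) * (1 - f x) \<le> real (card R) * (1 - f x)"
    using fx by (intro mult_right_mono) auto
  moreover have "real (card R) \<le> N\<^sup>2"
    using card_mono[OF _ RJ] finJ
    by (simp add: N_def card_cartesian_product power2_eq_square flip: of_nat_mult)
  then have "real (card R) * (2 * \<eta>) \<le> N\<^sup>2 * (2 * \<eta>)" using \<eta> by (intro mult_right_mono) auto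
  ultimately have "N\<^sup>2 * ((1 - 1 / real r) * (1 - f x)) \<le> N\<^sup>2 * (l + 2 * \<eta>)"
    by (simp add: algebra_simps)
  then have "(1 - 1 / real r) * (1 - f x) \<le> l + 2 * \<eta>" using N by simp
  moreover have "(1 / real r) * (1 - f x) \<le> (1 / real r) * 1" using fx by (intro mult_left_mono) auto
  ultimately show ?thesis by (simp add: l_def algebra_simps)
qed

theorem disagreement_bound_ge:
  assumes inf: "infinite (UNIV :: 'a set)" and f: "disagreement_bound TYPE('a) f"
    and x: "x \<in> {0..1}"
  shows "F x \<le> f x"
proof -
  have fx: "0 \<le> f x" "f x \<le> 1" using f x by (auto simp: disagreement_bound_def Pi_iff)
  consider "x = 0" | "x = 1" | "0 < x" "x < 1" using x by fastforce
  then show ?thesis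
  proof cases
    case 1
    then show ?thesis using fx by (simp add: F_def)
  next
    case 2
    \<comment> \<open>Two point masses at distinct points never agree, which settles distance 1 with
      no atom.\<close>
    have "real (card {(False, True)}) * (1 - f 1) \<le> 0 + real (card {(False, True)}) * (2 * 0)"
      by (rule disagreement_bound_agreement_le_transport
          [where J = UNIV and T = "\<lambda>b. {b}" and K = 1, OF inf f])
        (auto simp: card_eq_0_iff)
    then show ?thesis using 2 by (simp add: F_def)
  next
    case 3
    \<comment> \<open>The map \<open>y / (2 - y)\<close> is the inverse of \<open>F\<close>, so
      letting \<open>t\<close> tend to \<open>x\<close> gives the claim. The gap
      \<open>x - t\<close> makes room for \<open>M\<close>.\<close>
    have main: "t \<le> f x / (2 - f x)" if t: "0 < t" "t < x" for t
    proof -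
      have "1 - f x \<le> (1 - t) / (1 + t) + e" if "0 < e" for e
      proof -
        \<comment> \<open>The errors \<open>2 * t ^ M\<close>, \<open>2 * \<eta>\<close> and
          \<open>1 / r\<close> use two, two and one of the five shares.\<close>
        define d where "d = e / 5"
        have d: "0 < d" using \<open>0 < e\<close> by (simp add: d_def)
        obtain M where M: "t ^ M < d" using real_arch_pow_inv[OF d, of t] t 3 by auto
        \<comment> \<open>The three lower bounds on \<open>s\<close> give, in turn, the room for
          \<open>M\<close>, the bound \<open>\<eta> \<le> d\<close>, and
          \<open>0 < k\<close>.\<close>
        obtain s1 where s1: "real M / (x - t) < real s1" using reals_Archimedean2 by blast
        obtain s2 where s2: "1 / (x * d) < real s2" using reals_Archimedean2 by blast
        obtain s3 where s3: "1 / (1 - x) < real s3" using reals_Archimedean2 by blast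
        define s where "s = max s1 (max s2 s3)"
        have "real M / (x - t) < real s" "1 / (x * d) < real s" "1 / (1 - x) < real s"
          using s1 s2 s3 by (auto simp: s_def)
        then have s: "real M < real s * (x - t)" "1 < real s * (x * d)" "1 < real s * (1 - x)"
          using t 3 d by (auto simp: divide_less_eq)
        then have s0: "0 < s" by (cases s) auto
        \<comment> \<open>Rounding down makes \<open>1 - k / s\<close> at least \<open>x\<close>:
          the atom can only decrease distances, and \<open>\<eta>\<close> is then solved from the
          required equation.\<close>
        define k where "k = nat \<lfloor>real s * (1 - x)\<rfloor>"
        have k: "0 < k" "real k \<le> real s * (1 - x)" "real s * (1 - x) < real k + 1"
          using s(3) by (auto simp: k_def)
        have xs: "x \<le> 1 - real k / real s" using k s0 by (simp add: field_simps)
        have "real s * (1 - x) < real s" using 3 s0 by simp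
        then have ks: "k < s" using k(2) by linarith
        define \<eta> where "\<eta> = 1 - x / (1 - real k / real s)"
        have \<eta>: "0 \<le> \<eta>" "\<eta> \<le> 1" using xs 3 by (auto simp: \<eta>_def)
        have "(real s * (1 - x) - real k) / real s \<le> 1 / real s"
          using k(3) by (intro divide_right_mono) auto
        then have "1 - real k / real s - x \<le> 1 / real s" using s0 by (simp add: diff_divide_distrib)
        also have "\<dots> \<le> x * d" using s(2) s0 by (simp add: field_simps)
        also have "\<dots> \<le> (1 - real k / real s) * d" using xs d by (intro mult_right_mono) auto
        finally have "1 - real k / real s - x \<le> (1 - real k / real s) * d" .
        moreover have "0 < 1 - real k / real s" using xs 3 by linarith
        moreover have "\<eta> = (1 - real k / real s - x) / (1 - real k / real s)"
          using \<open>0 < 1 - real k / real s\<close> by (auto simp: \<eta>_def diff_divide_distrib)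
        ultimately have "\<eta> \<le> d" by (simp only: pos_divide_le_eq mult.commute)
        obtain r0 where r0: "1 / d < real r0" using reals_Archimedean2 by blast
        define r where "r = max 2 r0"
        have r: "2 \<le> r" "1 / d < real r" using r0 by (auto simp: r_def)
        then have rd: "1 / real r < d" using d by (simp add: field_simps)
        have "1 - f x \<le> (1 - t) / (1 + t) + 2 * t ^ M + 2 * \<eta> + 1 / real r"
        proof (rule disagreement_bound_slices[OF inf f _ _ k(1) ks _ r(1) \<eta>])
          show "t * real s + real M \<le> real s - real k"
            using s(1) k(2) by (simp add: algebra_simps)
          show "(1 - \<eta>) * (1 - real k / real s) = x" using xs 3 by (auto simp: \<eta>_def)
        qed (use t 3 in auto)
        also have "\<dots> \<le> (1 - t) / (1 + t) + 5 * d"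
          using M \<open>\<eta> \<le> d\<close> rd by linarith
        finally show ?thesis by (simp add: d_def)
      qed
      then have "1 - f x \<le> (1 - t) / (1 + t)" by (rule field_le_epsilon)
      then show ?thesis using t fx by (simp add: field_simps)
    qed
    have "x \<le> f x / (2 - f x)"
      using main by (intro dense_le_bounded[OF 3(1)]) auto
    then show ?thesis using fx 3 by (simp add: F_def field_simps)
  qed
qed

theorem theorem3:
  fixes f :: "real \<Rightarrow> real"
  assumes "infinite (UNIV :: 'a set)"
    and "disagreement_bound TYPE('a) f"
  shows "((\<forall>x\<in>{0..1}. f x \<le> F x) \<longrightarrow> (\<forall>x\<in>{0..1}. f x = F x)) \<and>
         (\<forall>a b. {a<..<b} \<subseteq> {0..1} \<longrightarrow>
            (\<forall>x\<in>{a<..<b}. f x \<le> F x) \<longrightarrow> (\<forall>x\<in>{a<..<b}. f x = F x))"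
  using disagreement_bound_ge[OF assms] by (meson order_antisym subsetD)

end
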